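(* Let $n,m,k$ be positive integers with $n>m\ge k\ge 2$. Then there exist designs $(A,c)$ with $A\in\mathbb{R}_{\ge 0}^{m\times n}$ and $c\in\mathbb{R}_{\ge 0}^n$ such that $$|\mathcal{L}^k(A,c)|\ge\begin{cases} f_{k-1}(\mathcal{C}(n,m)) & \text{if } k<m/2,\\ f_{k-1}(\mathcal{C}(n,m))/2 & \text{if } k\ge m/2.\end{cases}$$
   Context: For $A\in\mathbb{R}_{\ge0}^{m\times n}$, $c\in\mathbb{R}_{\ge0}^n$, $b\in\mathbb{R}_{\ge0}^m$, let $LP(A,c,b)$ be the linear program $\max\{c^\top x \mid Ax\le b,\ x\ge 0\}$. The pair $(A,c)$ is called a design. For $x\in\mathbb{R}^n_{\ge0}$, $\mathrm{supp}(x)=\{i\in[n]\mid x_i>0\}$, where $[n]=\{1,\dots,n\}$. A set $L\subseteq[n]$ is a loadout of $(A,c)$ if there exists $b\in\mathbb{R}^m_{\ge 0}$ such that $LP(A,c,b)$ has a unique optimal solution $x^*$ and $\mathrm{supp}(x^* )=L$. A loadout with $|L|=k$ is a $k$-loadout, and $\mathcal{L}^k(A,c)$ is the set of all $k$-loadouts of $(A,c)$. The cyclic polytope $\mathcal{C}(N,d)$ is the convex hull of $N$ distinct points on the moment curve $t\mapsto(t,t^2,\dots,t^d)$ in $\mathbb{R}^d$ (its combinatorial type does not depend on the choice of points). For a polytope $P$, $f_i(P)$ denotes the number of $i$-dimensional faces of $P$. *)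

theory Defs
  imports "HOL-Analysis.Analysis"
begin

(* [m] and [n] are rendered as finite index types 'm and 'n, so A :: real^'n^'m has m rows and
   n columns. The order on vectors and matrices is the library's entrywise order. *)

definition design :: "real^'n^'m \<Rightarrow> real^'n \<Rightarrow> bool" where
  "design A c \<longleftrightarrow> 0 \<le> A \<and> 0 \<le> c"

definition lp_feasible :: "real^'n^'m \<Rightarrow> real^'m \<Rightarrow> (real^'n) set" where
  "lp_feasible A b = {x. A *v x \<le> b \<and> 0 \<le> x}"

definition lp_optimal :: "real^'n^'m \<Rightarrow> real^'n \<Rightarrow> real^'m \<Rightarrow> real^'n \<Rightarrow> bool" where
  "lp_optimal A c b x \<longleftrightarrow> x \<in> lp_feasible A b \<and> (\<forall>y \<in> lp_feasible A b. c \<bullet> y \<le> c \<bullet> x)"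

definition supp :: "real^'n \<Rightarrow> 'n set" where
  "supp x = {i. x $ i > 0}"

definition loadout :: "real^'n^'m \<Rightarrow> real^'n \<Rightarrow> 'n set \<Rightarrow> bool" where
  "loadout A c L \<longleftrightarrow>
     (\<exists>b x. 0 \<le> b \<and> lp_optimal A c b x \<and> (\<forall>y. lp_optimal A c b y \<longrightarrow> y = x) \<and> supp x = L)"

definition k_loadouts :: "nat \<Rightarrow> real^'n^'m \<Rightarrow> real^'n \<Rightarrow> 'n set set" where
  "k_loadouts k A c = {L. loadout A c L \<and> card L = k}"

(* The linear order on the index type numbers the coordinates: card {j. j \<le> i} is the position
   of i, running through 1, ..., d, so this is t \<mapsto> (t, t^2, ..., t^d). *)
definition moment_curve :: "real \<Rightarrow> real^('d::{finite,linorder})" where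
  "moment_curve t = (\<chi> i. t ^ card {j. j \<le> i})"

(* P is a cyclic polytope C(N,d) with d = CARD('d), for some choice of N points on the moment
   curve. Distinct parameters give distinct points, since the first coordinate is t itself. *)
definition cyclic_polytope :: "nat \<Rightarrow> (real^('d::{finite,linorder})) set \<Rightarrow> bool" where
  "cyclic_polytope N P \<longleftrightarrow>
     (\<exists>T. finite T \<and> card T = N \<and> P = convex hull (moment_curve ` T))"

(* f_i(P) *)
definition face_number :: "nat \<Rightarrow> 'a::euclidean_space set \<Rightarrow> nat" where
  "face_number i P = card {F. F face_of P \<and> aff_dim F = int i}"

end

(* With c = (1, ..., 1), a set L is a loadout as soon as some y > 0 has y . a_i = 1 for the columns
   a_i with i in L, y . a_i > 1 for the others, and the columns in L are linearly independent; that
   is, L is a face of the convex hull of the columns with a positive inner normal. Any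
   finite family of faces whose inner normals lie in a common open half-space can be given positive
   normals by a linear change of coordinates, and translating along (1, ..., 1) makes the points
   nonnegative. So it suffices to find many faces of the cyclic polytope with inner normals in a
   half-space. A generic half-space or its opposite contains at least half of the normals. If
   2k <= m, every k-set L is cut out by the polynomial prod_{i in L} (t - t_i)^2, and all these
   normals have coordinate 1 in position 2k. *)

theory Submission
  imports Defs "HOL-Computational_Algebra.Polynomial"
begin

section \<open>Loadouts from strict dual certificates\<close>

lemma matrix_vector_mult_eq_sum_columns:
  fixes A :: "real^'n^'m"
  shows "A *v x = (\<Sum>i\<in>UNIV. x $ i *\<^sub>R column i A)"
  by (simp add: vec_eq_iff matrix_vector_mult_def column_def mult.commute)

text \<open>Strict complementary slackness, with the indicator vector of \<open>L\<close> as primal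
  solution and its load as \<open>b\<close>. Since \<open>y\<close> is dual feasible with the same
  value, an optimal \<open>z\<close> vanishes wherever the dual constraint is strict, that is, off
  \<open>L\<close>, and uses up all of \<open>b\<close> because \<open>y\<close> is positive.
  Independence of the columns in \<open>L\<close> then leaves only one solution.\<close>

lemma loadout_if_dual_certificate:
  fixes A :: "real^'n^'m" and c :: "real^'n" and y :: "real^'m"
  assumes A: "0 \<le> A"
    and y: "\<And>j. y $ j > 0"
    and tight: "\<And>i. i \<in> L \<Longrightarrow> y \<bullet> column i A = c $ i"
    and slack: "\<And>i. i \<notin> L \<Longrightarrow> y \<bullet> column i A > c $ i"
    and indep: "\<And>l. (\<Sum>i\<in>L. l i *\<^sub>R column i A) = 0 \<Longrightarrow> \<forall>i\<in>L. l i = 0"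
  shows "loadout A c L"
proof -
  define x :: "real^'n" where "x = (\<chi> i. if i \<in> L then 1 else 0)"
  define b where "b = A *v x"
  have x0: "0 \<le> x" by (simp add: x_def less_eq_vec_def)
  have b0: "0 \<le> b"
    using A by (auto simp: b_def x_def less_eq_vec_def matrix_vector_mult_def intro!: sum_nonneg)
  have yA: "y \<bullet> (A *v z) = (\<Sum>i\<in>UNIV. z $ i * (y \<bullet> column i A))" for z
    by (simp add: matrix_vector_mult_eq_sum_columns inner_sum_right)
  have cz: "c \<bullet> z = (\<Sum>i\<in>UNIV. z $ i * c $ i)" for z
    by (simp add: inner_vec_def mult.commute)
  have le: "c $ i \<le> y \<bullet> column i A" for i
    using tight[of i] slack[of i] by (cases "i \<in> L") auto
  have cx: "c \<bullet> x = y \<bullet> b"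
    unfolding b_def yA cz by (rule sum.cong) (auto simp: x_def tight)
  have weak: "c \<bullet> z \<le> y \<bullet> (A *v z)" if "0 \<le> z" for z
    unfolding yA cz using that le
    by (intro sum_mono mult_left_mono) (auto simp: less_eq_vec_def)
  have yb: "y \<bullet> z \<le> y \<bullet> b" if "z \<le> b" for z
    unfolding inner_vec_def using that y
    by (intro sum_mono) (auto simp: less_eq_vec_def less_imp_le)
  have feas: "x \<in> lp_feasible A b"
    using x0 by (simp add: lp_feasible_def b_def)
  have opt: "lp_optimal A c b x"
    unfolding lp_optimal_def using feas weak yb cx
    by (fastforce simp: lp_feasible_def)
  have uniq: "z = x" if "lp_optimal A c b z" for z
  proof -
    from that have z: "A *v z \<le> b" "0 \<le> z" and "c \<bullet> x \<le> c \<bullet> z"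
      using feas by (auto simp: lp_optimal_def lp_feasible_def)
    then have e1: "c \<bullet> z = y \<bullet> (A *v z)" and e2: "y \<bullet> (A *v z) = y \<bullet> b"
      using weak[OF z(2)] yb[OF z(1)] cx by linarith+
    have "(\<Sum>i\<in>UNIV. z $ i * (y \<bullet> column i A - c $ i)) = 0"
      using e1 unfolding yA cz by (simp add: right_diff_distrib sum_subtractf)
    then have "\<forall>i\<in>UNIV. z $ i * (y \<bullet> column i A - c $ i) = 0"
      using z le by (subst (asm) sum_nonneg_eq_0_iff) (auto simp: less_eq_vec_def)
    then have zL: "z $ i = 0" if "i \<notin> L" for i
      using slack[OF that] by (metis UNIV_I eq_iff_diff_eq_0 less_irrefl mult_eq_0_iff)
    have "(\<Sum>j\<in>UNIV. y $ j * (b $ j - (A *v z) $ j)) = 0"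
      using e2 by (simp add: inner_vec_def right_diff_distrib sum_subtractf)
    then have "\<forall>j\<in>UNIV. y $ j * (b $ j - (A *v z) $ j) = 0"
      using z y by (subst (asm) sum_nonneg_eq_0_iff) (auto simp: less_eq_vec_def less_imp_le)
    then have "b $ j = (A *v z) $ j" for j
      using y[of j] by (metis UNIV_I eq_iff_diff_eq_0 less_irrefl mult_eq_0_iff)
    then have "A *v (z - x) = 0"
      by (simp add: vec_eq_iff b_def matrix_vector_mult_diff_distrib)
    moreover have "A *v (z - x) = (\<Sum>i\<in>L. (z - x) $ i *\<^sub>R column i A)"
      unfolding matrix_vector_mult_eq_sum_columns
      by (rule sum.mono_neutral_right) (auto simp: zL x_def)
    ultimately have "\<forall>i\<in>L. (z - x) $ i = 0"
      using indep[of "\<lambda>i. (z - x) $ i"] by simp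
    then have "(z - x) $ i = 0" for i
      using zL[of i] by (cases "i \<in> L") (auto simp: x_def)
    then show "z = x" by (simp add: vec_eq_iff)
  qed
  have "supp x = L" by (auto simp: supp_def x_def)
  then show ?thesis
    unfolding loadout_def using b0 opt uniq by blast
qed

section \<open>From supporting normals in a half-space to designs\<close>

text \<open>For a finite family, \<open>L\<close> indexes the points on the face of the convex hull
  with inner normal \<open>u\<close>. The bound \<beta> need not be attained, so
  \<open>L = {}\<close> is possible.\<close>

definition supports :: "('n \<Rightarrow> 'a::real_inner) \<Rightarrow> 'a \<Rightarrow> 'n set \<Rightarrow> bool" where
  "supports v u L \<longleftrightarrow> (\<exists>\<beta>. \<forall>i. \<beta> \<le> u \<bullet> v i \<and> (u \<bullet> v i = \<beta> \<longleftrightarrow> i \<in> L))"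

text \<open>Phrased for an indexed family, unlike the set-based \<open>affine_dependent\<close>, so
  that a repeated point counts as a dependence and \<open>l\<close> can serve directly as
  coefficients of matrix columns.\<close>

definition affinely_independent_on :: "('n \<Rightarrow> 'a::real_vector) \<Rightarrow> 'n set \<Rightarrow> bool" where
  "affinely_independent_on v L \<longleftrightarrow>
     (\<forall>l. sum l L = 0 \<longrightarrow> (\<Sum>i\<in>L. l i *\<^sub>R v i) = (0::'a) \<longrightarrow> (\<forall>i\<in>L. l i = 0))"

text \<open>The map \<open>M\<close> pushes all \<open>u\<close> with \<open>w \<bullet> u > 0\<close> into the positive orthant, since it is a small
  perturbation of \<open>u \<mapsto> (w \<bullet> u) (1, \<dots>, 1)\<close>; \<open>N\<close> is its inverse transpose (Sherman--Morrison).\<close>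

lemma halfspace_into_positive_orthant:
  fixes U :: "(real^'m) set" and w :: "real^'m"
  assumes "finite U" and "\<And>u. u \<in> U \<Longrightarrow> w \<bullet> u > 0"
  obtains M N :: "real^'m \<Rightarrow> real^'m" where "linear N"
    and "\<And>u x. M u \<bullet> N x = u \<bullet> x" and "\<And>u j. u \<in> U \<Longrightarrow> M u $ j > 0"
proof -
  \<comment> \<open>The matrix of \<open>M\<close> will be \<open>e\<close> times the identity plus
    a rank-one term. The denominator in its inverse is \<open>e + \<sigma>\<close>, hence the
    condition \<open>e \<noteq> - \<sigma>\<close> below.\<close>
  define \<sigma> where "\<sigma> = w \<bullet> 1"
  have ev: "\<forall>\<^sub>F e in at_right 0. w \<bullet> u + e * u $ j > 0" if "u \<in> U" for u j
  proof -
    have "((\<lambda>e. w \<bullet> u + e * u $ j) \<longlongrightarrow> w \<bullet> u + 0 * u $ j) (at_right 0)"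
      by (intro tendsto_intros)
    then show ?thesis
      using assms(2)[OF that] by (simp add: order_tendstoD(1))
  qed
  have "\<forall>\<^sub>F e in at_right (0::real). (\<forall>u\<in>U. \<forall>j\<in>UNIV. w \<bullet> u + e * u $ j > 0) \<and> e > 0 \<and> e \<noteq> - \<sigma>"
  proof (intro eventually_conj eventually_ball_finite ballI ev assms(1) finite)
    show "\<forall>\<^sub>F e in at_right (0::real). e > 0"
      by (simp add: eventually_at_right_less)
    show "\<forall>\<^sub>F e in at_right (0::real). e \<noteq> - \<sigma>"
      using eventually_neq_at_within by blast
  qed
  then obtain e where e: "\<And>u j. u \<in> U \<Longrightarrow> w \<bullet> u + e * u $ j > 0" "e > 0" "e \<noteq> - \<sigma>"
    using eventually_happens'[OF trivial_limit_at_right_real] by blast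
  define M :: "real^'m \<Rightarrow> real^'m" where "M u = (w \<bullet> u) *\<^sub>R 1 + e *\<^sub>R u" for u
  define N :: "real^'m \<Rightarrow> real^'m"
    where "N x = (1 / e) *\<^sub>R (x - ((1 \<bullet> x) / (e + \<sigma>)) *\<^sub>R w)" for x
  show thesis
  proof
    show "linear N"
      by (rule linearI) (simp_all add: N_def inner_add_right algebra_simps add_divide_distrib
          scaleR_add_left[symmetric] del: scaleR_add_left)
    show "M u \<bullet> N x = u \<bullet> x" for u x
    proof -
      define d where "d = (1 \<bullet> x) / (e + \<sigma>)"
      have d: "d * (e + \<sigma>) = 1 \<bullet> x" using e(3) by (simp add: d_def add_eq_0_iff)
      have "1 \<bullet> w = \<sigma>" "u \<bullet> w = w \<bullet> u" by (simp_all add: \<sigma>_def inner_commute)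
      then have "M u \<bullet> N x = (1 / e) * ((w \<bullet> u) * (1 \<bullet> x - d * \<sigma>) + e * (u \<bullet> x - d * (w \<bullet> u)))"
        unfolding M_def N_def d_def[symmetric] by (simp add: inner_diff_right inner_add_left)
          (simp add: algebra_simps)
      also have "\<dots> = (1 / e) * ((w \<bullet> u) * (1 \<bullet> x - d * (e + \<sigma>)) + e * (u \<bullet> x))"
        by (simp add: algebra_simps)
      finally show ?thesis using d e(2) by simp
    qed
    show "M u $ j > 0" if "u \<in> U" for u j
      using e(1)[OF that, of j] by (simp add: M_def)
  qed
qed

text \<open>The columns are the points \<open>N (v i)\<close> translated by \<open>s\<close> along
  \<open>1\<close>. Pairing with \<open>M (u L)\<close> reproduces the values
  \<open>u L \<bullet> v i\<close> up to a shift independent of \<open>i\<close>, so the minimum is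
  still attained exactly on \<open>L\<close>; scaling it to 1 gives a dual certificate for the cost
  vector \<open>1\<close>.\<close>

lemma ex_design_with_loadouts:
  fixes v :: "'n::finite \<Rightarrow> real^'m" and w :: "real^'m"
  assumes supp: "\<And>L. L \<in> \<F> \<Longrightarrow> supports v (u L) L"
    and pos: "\<And>L. L \<in> \<F> \<Longrightarrow> w \<bullet> u L > 0"
    and indep: "\<And>L. L \<in> \<F> \<Longrightarrow> affinely_independent_on v L"
  obtains A :: "real^'n^'m" and c :: "real^'n"
  where "design A c" and "\<And>L. L \<in> \<F> \<Longrightarrow> loadout A c L"
proof -
  have "finite \<F>" by simp
  then have fin: "finite (u ` \<F>)" by simp
  have posU: "w \<bullet> a > 0" if "a \<in> u ` \<F>" for a using that pos by auto
  obtain M N :: "real^'m \<Rightarrow> real^'m" where N: "linear N" and MN: "\<And>a x. M a \<bullet> N x = a \<bullet> x"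
    and M: "\<And>a j. a \<in> u ` \<F> \<Longrightarrow> M a $ j > 0"
    by (rule halfspace_into_positive_orthant[OF fin, of w]) (erule posU, rule that)
  obtain \<beta> where \<beta>: "\<And>L i. L \<in> \<F> \<Longrightarrow> \<beta> L \<le> u L \<bullet> v i"
    "\<And>L i. L \<in> \<F> \<Longrightarrow> u L \<bullet> v i = \<beta> L \<longleftrightarrow> i \<in> L"
    using supp unfolding supports_def by metis
  have M1: "M (u L) \<bullet> 1 > 0" if "L \<in> \<F>" for L
    using M that by (auto simp: inner_vec_def intro!: sum_pos)
  \<comment> \<open>The first bound on \<open>s\<close> makes the entries of \<open>A\<close>
    nonnegative, the second makes the minimum \<gamma> of each translated functional positive, so
    that it can be scaled to 1.\<close>
  have "\<forall>\<^sub>F s in at_top. (\<forall>i\<in>UNIV. \<forall>j\<in>UNIV. - (N (v i) $ j) \<le> s)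
      \<and> (\<forall>L\<in>\<F>. - \<beta> L / (M (u L) \<bullet> 1) < s)"
    by (intro eventually_conj eventually_ball_finite ballI \<open>finite \<F>\<close> finite
        eventually_ge_at_top eventually_gt_at_top)
  then obtain s where s1: "\<And>i j. - (N (v i) $ j) \<le> s"
    and s2: "\<And>L. L \<in> \<F> \<Longrightarrow> - \<beta> L / (M (u L) \<bullet> 1) < s"
    using eventually_happens'[OF trivial_limit_at_top_linorder] by blast
  define \<gamma> where "\<gamma> L = \<beta> L + s * (M (u L) \<bullet> 1)" for L
  have \<gamma>: "\<gamma> L > 0" if "L \<in> \<F>" for L
    using s2[OF that] M1[OF that] by (simp add: \<gamma>_def divide_simps)
  define A :: "real^'n^'m" where "A = (\<chi> j i. N (v i) $ j + s)"
  have col: "column i A = N (v i) + s *\<^sub>R 1" for i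
    by (simp add: vec_eq_iff column_def A_def)
  have A0: "0 \<le> A"
    using s1 by (simp add: less_eq_vec_def A_def) (smt (verit))
  have "loadout A 1 L" if L: "L \<in> \<F>" for L
  proof -
    define y where "y = (1 / \<gamma> L) *\<^sub>R M (u L)"
    have y_col: "y \<bullet> column i A = 1 + (u L \<bullet> v i - \<beta> L) / \<gamma> L" for i
      using \<gamma>[OF L] by (simp add: y_def col inner_add_right MN \<gamma>_def divide_simps)
    have tight: "y \<bullet> column i A = 1" if "i \<in> L" for i
      using \<beta>(2)[OF L, of i] that by (simp add: y_col)
    show ?thesis
    proof (rule loadout_if_dual_certificate[OF A0, of y])
      show "y $ j > 0" for j
        using M[of "u L" j] \<gamma>[OF L] L by (simp add: y_def)
      show "y \<bullet> column i A = 1 $ i" if "i \<in> L" for i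
        using tight[OF that] by simp
      show "1 $ i < y \<bullet> column i A" if "i \<notin> L" for i
        using \<beta>[OF L, of i] \<gamma>[OF L] that by (simp add: y_col)
      fix l assume l: "(\<Sum>i\<in>L. l i *\<^sub>R column i A) = 0"
      have "y \<bullet> (\<Sum>i\<in>L. l i *\<^sub>R column i A) = sum l L"
        by (simp add: inner_sum_right tight)
      then have l0: "sum l L = 0" using l by simp
      have "N (\<Sum>i\<in>L. l i *\<^sub>R v i) = (\<Sum>i\<in>L. l i *\<^sub>R N (v i))"
        using N by (simp add: linear_sum linear_scale)
      also have "\<dots> = (\<Sum>i\<in>L. l i *\<^sub>R column i A) - (sum l L * s) *\<^sub>R 1"
        by (simp add: col scaleR_add_right sum.distrib scaleR_sum_left sum_distrib_right)
      finally have "N (\<Sum>i\<in>L. l i *\<^sub>R v i) = 0" using l l0 by simp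
      \<comment> \<open>\<open>N\<close> is injective: \<open>MN\<close> with both arguments equal
        to \<open>x\<close> gives \<open>x \<bullet> x = M x \<bullet> N x\<close>.\<close>
      then have "(\<Sum>i\<in>L. l i *\<^sub>R v i) \<bullet> (\<Sum>i\<in>L. l i *\<^sub>R v i) = 0"
        by (metis MN inner_zero_right)
      then show "\<forall>i\<in>L. l i = 0"
        using indep[OF L] l0 by (simp add: affinely_independent_on_def)
    qed
  qed
  moreover have "design A 1"
    using A0 by (simp add: design_def less_eq_vec_def)
  ultimately show thesis using that by blast
qed

text \<open>Finitely many hyperplanes form a null set and so cannot cover the space.\<close>

lemma ex_not_orthogonal_to_finite:
  fixes U :: "'a::euclidean_space set"
  assumes "finite U" and "0 \<notin> U"
  obtains w where "\<And>u. u \<in> U \<Longrightarrow> w \<bullet> u \<noteq> 0"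
proof -
  have "negligible (\<Union>u\<in>U. {x. u \<bullet> x = 0})"
    using assms by (intro negligible_Union) (auto intro!: negligible_hyperplane)
  then have "(\<Union>u\<in>U. {x. u \<bullet> x = 0}) \<noteq> UNIV"
    using non_negligible_UNIV by metis
  then obtain w where "w \<notin> (\<Union>u\<in>U. {x. u \<bullet> x = 0})" by blast
  then show thesis using that[of w] by (auto simp: inner_commute)
qed

section \<open>Polynomials as affine functionals on the moment curve\<close>

lemma card_position_bij:
  "bij_betw (\<lambda>i::'m::{finite,linorder}. card {j. j \<le> i}) UNIV {1..CARD('m)}"
proof -
  have mono: "card {j. j \<le> i} < card {j. j \<le> i'}" if "i < i'" for i i' :: 'm
  proof (rule psubset_card_mono)
    have "i' \<in> {j. j \<le> i'} - {j. j \<le> i}" using that by simp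
    then show "{j. j \<le> i} \<subset> {j. j \<le> i'}" using that by force
  qed simp
  have inj: "inj (\<lambda>i::'m. card {j. j \<le> i})"
    by (rule injI) (metis mono less_irrefl linorder_neqE)
  have "range (\<lambda>i::'m. card {j. j \<le> i}) = {1..CARD('m)}"
  proof (rule card_subset_eq)
    show "range (\<lambda>i::'m. card {j. j \<le> i}) \<subseteq> {1..CARD('m)}"
      by (auto simp: Suc_le_eq card_gt_0_iff intro!: card_mono)
  qed (simp_all add: card_image[OF inj])
  then show ?thesis using inj by (simp add: bij_betw_def)
qed

text \<open>The constant coefficient has no coordinate; it becomes the offset of the affine
  functional.\<close>

definition poly_normal :: "real poly \<Rightarrow> real^('m::{finite,linorder})" where
  "poly_normal q = (\<chi> i. coeff q (card {j. j \<le> i}))"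

text \<open>This turns questions about hyperplanes and points of the curve into questions about
  signs and roots of polynomials.\<close>

lemma poly_eq_inner_moment_curve:
  fixes t :: real
  assumes "degree q \<le> CARD('m::{finite,linorder})"
  shows "poly q t = coeff q 0 + poly_normal q \<bullet> (moment_curve t :: (real,'m) vec)"
proof -
  have "poly_normal q \<bullet> (moment_curve t :: (real,'m) vec) = (\<Sum>j=1..CARD('m). coeff q j * t ^ j)"
    unfolding inner_vec_def
    using sum.reindex_bij_betw[OF card_position_bij, of "\<lambda>j. coeff q j * t ^ j"]
    by (simp add: poly_normal_def moment_curve_def)
  moreover have "poly q t = (\<Sum>j\<le>CARD('m). coeff q j * t ^ j)"
    unfolding poly_altdef using assms
    by (intro sum.mono_neutral_left) (auto simp: coeff_eq_0)
  moreover have "{..CARD('m)} = insert 0 {1..CARD('m)}" by auto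
  ultimately show ?thesis by simp
qed

lemma inj_moment_curve: "inj (moment_curve :: real \<Rightarrow> real^('m::{finite,linorder}))"
proof (rule injI)
  fix s t assume "(moment_curve s :: (real,'m) vec) = moment_curve t"
  moreover have "x = poly_normal [:0, 1:] \<bullet> (moment_curve x :: (real,'m) vec)" for x
    using poly_eq_inner_moment_curve[where 'm='m and q="[:0,1:]" and t=x] by (simp add: Suc_leI)
  ultimately show "s = t" by metis
qed

text \<open>The polynomial with roots at all parameters except \<open>e i\<close> has low enough
  degree to be an affine functional along the curve; applied to an affine dependence it isolates
  \<open>l i\<close>.\<close>

lemma affinely_independent_moment_curve:
  assumes "finite L" and "inj_on e L" and "card L \<le> CARD('m::{finite,linorder}) + 1"
  shows "affinely_independent_on (\<lambda>i. moment_curve (e i) :: real^('m::{finite,linorder})) L"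
  unfolding affinely_independent_on_def
proof (intro allI impI ballI)
  fix l i
  assume l: "sum l L = 0" "(\<Sum>i\<in>L. l i *\<^sub>R (moment_curve (e i) :: (real,'m) vec)) = 0" and i: "i \<in> L"
  define q where "q = (\<Prod>j\<in>L - {i}. [:- e j, 1:])"
  have "degree q \<le> (\<Sum>j\<in>L - {i}. degree [:- e j, 1:])"
    unfolding q_def using assms(1) degree_prod_sum_le[of "L - {i}" "\<lambda>j. [:- e j, 1:]"]
    by (simp add: o_def)
  also have "\<dots> \<le> CARD('m)" using assms i by (simp add: card_Diff_singleton)
  finally have q: "degree q \<le> CARD('m)" .
  have "(\<Sum>j\<in>L. l j * poly q (e j))
      = coeff q 0 * sum l L + poly_normal q \<bullet> (\<Sum>j\<in>L. l j *\<^sub>R (moment_curve (e j) :: (real,'m) vec))"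
    by (simp add: poly_eq_inner_moment_curve[OF q] inner_sum_right sum_distrib_left
        sum_distrib_right sum.distrib algebra_simps)
  also have "\<dots> = 0" using l by simp
  finally have "(\<Sum>j\<in>L. l j * poly q (e j)) = 0" .
  moreover have "(\<Sum>j\<in>L. l j * poly q (e j)) = (\<Sum>j\<in>{i}. l j * poly q (e j))"
    using assms(1) i by (intro sum.mono_neutral_right) (auto simp: q_def poly_prod)
  moreover have "poly q (e i) \<noteq> 0"
    using assms i by (auto simp: q_def poly_prod inj_on_def)
  ultimately show "l i = 0" by simp
qed

lemma aff_dim_moment_curve:
  assumes "finite S" and "card S \<le> CARD('m::{finite,linorder}) + 1"
  shows "aff_dim (moment_curve ` S :: (real^('m::{finite,linorder})) set) = int (card S) - 1"
proof -
  have inj: "inj_on (moment_curve :: real \<Rightarrow> (real,'m) vec) S"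
    using inj_moment_curve inj_on_subset by blast
  have ai: "affinely_independent_on (moment_curve :: real \<Rightarrow> (real,'m) vec) S"
    using affinely_independent_moment_curve[of S "\<lambda>x. x"] assms by simp
  have "\<not> affine_dependent (moment_curve ` S :: ((real,'m) vec) set)"
  proof
    assume "affine_dependent (moment_curve ` S :: ((real,'m) vec) set)"
    then obtain U where U: "sum U (moment_curve ` S) = 0"
      "\<exists>v\<in>moment_curve ` S. U v \<noteq> 0"
      "(\<Sum>v\<in>moment_curve ` S. U v *\<^sub>R v) = (0 :: (real,'m) vec)"
      using assms(1) by (auto simp: affine_dependent_explicit_finite)
    then show False
      using ai[unfolded affinely_independent_on_def, rule_format, of "\<lambda>s. U (moment_curve s)"]
      by (auto simp: sum.reindex[OF inj])
  qed
  from aff_dim_affine_independent[OF this] show ?thesis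
    by (simp add: card_image[OF inj])
qed

section \<open>Faces of the cyclic polytope\<close>

text \<open>A face is sent to the index set of the generators on it. This is injective because a
  face is the hull of those generators. The set has exactly \<open>k\<close> elements because the
  polytope is simplicial, and it has a supporting normal because faces of polyhedra are
  exposed.\<close>

lemma face_number_le_card_supported:
  fixes e :: "'n::finite \<Rightarrow> real"
  assumes e: "inj e" and "1 \<le> k" and "k \<le> CARD('m::{finite,linorder})"
  shows "face_number (k - 1) (convex hull (range (\<lambda>i. moment_curve (e i) :: (real,'m) vec)))
    \<le> card {L. card L = k \<and> (\<exists>u. supports (\<lambda>i. moment_curve (e i) :: (real,'m) vec) u L)}"
    (is "face_number _ ?P \<le> card ?G")
proof -
  define v where "v i = (moment_curve (e i) :: (real,'m) vec)" for i
  let ?F = "{F. F face_of ?P \<and> aff_dim F = int (k - 1)}"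
  define V where "V F = {i. v i \<in> F}" for F
  have vP: "v i \<in> ?P" for i
    unfolding v_def by (rule hull_inc) simp
  have poly: "polyhedron ?P"
    by (simp add: polyhedron_convex_hull)
  have hullV: "F = convex hull (v ` V F)" if F: "F face_of ?P" for F
  proof -
    obtain S where S: "S \<subseteq> range v" "F = convex hull S"
      by (rule face_of_convex_hull_subset[OF _ F])
        (auto simp: v_def[abs_def] finite_imp_compact)
    then have "S \<subseteq> v ` V F"
      by (auto simp: V_def intro: hull_inc)
    then have "F \<subseteq> convex hull (v ` V F)" using S(2) hull_mono by blast
    moreover have "convex hull (v ` V F) \<subseteq> F"
      using that by (intro hull_minimal) (auto simp: V_def face_of_imp_convex)
    ultimately show ?thesis by blast
  qed
  have inj: "inj_on V ?F"
    by (rule inj_onI) (metis (mono_tags, lifting) hullV mem_Collect_eq)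
  have img: "V ` ?F \<subseteq> ?G"
  proof
    fix L assume "L \<in> V ` ?F"
    then obtain F where F: "F face_of ?P" "aff_dim F = int (k - 1)" "L = V F" by auto
    have aff: "aff_dim (v ` L) = int (k - 1)"
      using hullV[OF F(1)] F(2,3) by (metis aff_dim_convex_hull)
    have dim: "aff_dim (v ` K) = int (card K) - 1" if "card K \<le> CARD('m) + 1" for K
      using aff_dim_moment_curve[where 'm='m, of "e ` K"] that e
      by (simp add: v_def image_image card_image inj_on_subset)
    \<comment> \<open>The dimension formula covers at most \<open>CARD('m) + 1\<close> points, so
      \<open>L\<close> is bounded first: that many points would already span dimension
      \<open>CARD('m)\<close>, which exceeds \<open>k - 1\<close>.\<close>
    have "card L \<le> CARD('m) + 1"
    proof (rule ccontr)
      assume "\<not> ?thesis"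
      then obtain K where K: "K \<subseteq> L" "card K = CARD('m) + 1"
        by (metis nat_le_linear obtain_subset_with_card_n)
      then have "aff_dim (v ` K) \<le> aff_dim (v ` L)"
        by (intro aff_dim_subset) auto
      then show False using dim[of K] K aff assms by simp
    qed
    then have card: "card L = k" using dim[of L] aff assms(2) by simp
    obtain a b where ab: "?P \<subseteq> {x. a \<bullet> x \<le> b}" "F = ?P \<inter> {x. a \<bullet> x = b}"
      using F(1) exposed_face_of_polyhedron[OF poly] unfolding exposed_face_of_def by blast
    \<comment> \<open>Exposed faces are given by maxima, \<open>supports\<close> by minima, hence
      the sign.\<close>
    have "supports v (- a) L"
      unfolding supports_def
    proof (intro exI allI conjI)
      fix i
      show "- b \<le> - a \<bullet> v i" using ab(1) vP[of i] by auto
      show "- a \<bullet> v i = - b \<longleftrightarrow> i \<in> L"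
        using ab(2) vP[of i] by (auto simp: F(3) V_def)
    qed
    then show "L \<in> ?G" using card unfolding v_def by blast
  qed
  show ?thesis
    unfolding face_number_def using card_inj_on_le[OF inj img] by simp
qed

text \<open>The witnessing polynomial is monic of degree \<open>2 * card L\<close>, so all these supporting
  normals agree in the coordinate \<open>2 * card L\<close>.\<close>

lemma neighborly_supports:
  fixes e :: "'n::finite \<Rightarrow> real"
  defines "q \<equiv> \<lambda>L. \<Prod>i\<in>L. [:- e i, 1:]\<^sup>2"
  assumes "inj e" and "2 * card L \<le> CARD('m::{finite,linorder})"
  shows "supports (\<lambda>i. moment_curve (e i) :: (real,'m) vec) (poly_normal (q L)) L"
    and "coeff (q L) (2 * card L) = 1"
proof -
  have "degree (q L) = (\<Sum>i\<in>L. degree ([:- e i, 1:]\<^sup>2))"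
    unfolding q_def by (rule degree_prod_eq_sum_degree) auto
  then have deg: "degree (q L) = 2 * card L"
    by (simp add: degree_power_eq)
  have "lead_coeff (q L) = 1"
    by (simp add: q_def lead_coeff_prod lead_coeff_power)
  then show "coeff (q L) (2 * card L) = 1" by (simp add: deg)
  have dm: "degree (q L) \<le> CARD('m)" using deg assms by simp
  have val: "poly (q L) t = (\<Prod>i\<in>L. (t - e i)\<^sup>2)" for t
    by (simp add: q_def poly_prod poly_power)
  have "0 \<le> poly (q L) t" for t
    by (simp add: val prod_nonneg)
  moreover have "poly (q L) (e i) = 0 \<longleftrightarrow> i \<in> L" for i
    using assms(2) by (auto simp: val inj_eq)
  ultimately show "supports (\<lambda>i. moment_curve (e i) :: (real,'m) vec) (poly_normal (q L)) L"
    unfolding supports_def using poly_eq_inner_moment_curve[OF dm]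
    by (intro exI[of _ "- coeff (q L) 0"]) (smt (verit))
qed

section \<open>Counting loadouts\<close>

theorem theorem2:
  fixes k :: nat and P :: "(real^('m::{finite,linorder})) set"
  assumes "CARD('n::finite) > CARD('m)" and "CARD('m) \<ge> k" and "k \<ge> 2"
    and "cyclic_polytope CARD('n) P"
  shows "\<exists>(A :: real^'n^('m::{finite,linorder})) (c :: real^'n). design A c \<and>
    real (card (k_loadouts k A c)) \<ge>
      (if real k < real CARD('m) / 2 then real (face_number (k - 1) P)
       else real (face_number (k - 1) P) / 2)"
proof -
  obtain T where T: "finite T" "card T = CARD('n)" "P = convex hull (moment_curve ` T)"
    using assms(4) unfolding cyclic_polytope_def by blast
  obtain e :: "'n \<Rightarrow> real" where "bij_betw e UNIV T"
    using finite_same_card_bij[of "UNIV :: 'n set" T] T by auto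
  then have e: "inj e" "range e = T" by (auto simp: bij_betw_def)
  define v where "v i = (moment_curve (e i) :: (real,'m) vec)" for i
  define G where "G = {L. card L = k \<and> (\<exists>u. supports v u L)}"
  have "P = convex hull (range (\<lambda>i. moment_curve (e i)))"
    using T(3) e(2) by (metis image_image)
  then have faces: "face_number (k - 1) P \<le> card G"
    using face_number_le_card_supported[OF e(1), of k, where 'm='m] assms
    by (simp add: G_def v_def[abs_def])
  have indep: "affinely_independent_on v L" if "card L = k" for L
    unfolding v_def using affinely_independent_moment_curve[where 'm='m, of L e] that e(1) assms(2)
    by (simp add: inj_on_subset)
  \<comment> \<open>Both cases reduce to choosing a large family of supported \<open>k\<close>-sets
    whose normals lie in one open half-space, given by \<open>w\<close>.\<close>
  have main: "\<exists>(A :: ((real, 'n) vec, 'm) vec) c. design A c \<and> card \<F> \<le> card (k_loadouts k A c)"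
    if card: "\<And>L. L \<in> \<F> \<Longrightarrow> card L = k" and \<F>: "\<And>L. L \<in> \<F> \<Longrightarrow> supports v (u L) L"
      "\<And>L. L \<in> \<F> \<Longrightarrow> w \<bullet> u L > 0" for \<F> u w
  proof -
    have ind: "affinely_independent_on v L" if "L \<in> \<F>" for L
      using card indep that by blast
    obtain A :: "((real, 'n) vec, 'm) vec" and c where "design A c" "\<And>L. L \<in> \<F> \<Longrightarrow> loadout A c L"
      using ex_design_with_loadouts[OF \<F> ind] by blast
    moreover from this have "\<F> \<subseteq> k_loadouts k A c"
      using card by (auto simp: k_loadouts_def)
    ultimately show ?thesis by (meson card_mono finite)
  qed
  show ?thesis
  proof (cases "real k < real CARD('m) / 2")
    case True
    then have k: "2 * k \<le> CARD('m)" by linarith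
    \<comment> \<open>The coordinate in position \<open>2 * k\<close> exists since
      \<open>2 * k\<close> is at most \<open>CARD('m)\<close>; it picks out the leading coefficient
      1 of every witnessing polynomial.\<close>
    have "2 * k \<in> range (\<lambda>j::'m. card {i. i \<le> j})"
      using k assms(3) by (simp add: bij_betw_imp_surj_on[OF card_position_bij])
    then obtain j :: 'm where j: "card {i. i \<le> j} = 2 * k" by auto
    define u :: "'n set \<Rightarrow> (real,'m) vec" where "u L = poly_normal (\<Prod>i\<in>L. [:- e i, 1:]\<^sup>2)" for L
    let ?\<F> = "{L :: 'n set. card L = k}"
    have "\<exists>(A :: ((real, 'n) vec, 'm) vec) c. design A c \<and> card ?\<F> \<le> card (k_loadouts k A c)"
    proof (rule main[where u=u and w="axis j 1"])
      fix L :: "'n set" assume "L \<in> ?\<F>"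
      then show "card L = k" by simp
      with k have L: "2 * card L \<le> CARD('m)" by simp
      show "supports v (u L) L"
        unfolding u_def v_def by (rule neighborly_supports(1)[OF e(1) L])
      show "axis j 1 \<bullet> u L > 0"
        using neighborly_supports(2)[OF e(1) L] \<open>card L = k\<close>
        by (simp add: u_def inner_axis' poly_normal_def j)
    qed
    then obtain A :: "((real, 'n) vec, 'm) vec" and c
      where A: "design A c" "card ?\<F> \<le> card (k_loadouts k A c)" by blast
    have "card G \<le> card ?\<F>"
      by (rule card_mono) (auto simp: G_def)
    then have "face_number (k - 1) P \<le> card (k_loadouts k A c)"
      using A(2) faces by linarith
    then show ?thesis using A(1) True by auto
  next
    case False
    define u where "u L = (SOME u. supports v u L)" for L
    have u: "supports v (u L) L" if "L \<in> G" for L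
      using that unfolding G_def u_def by (metis (mono_tags, lifting) mem_Collect_eq someI_ex)
    \<comment> \<open>A zero normal supports only the empty and the full index set, whose sizes are
      excluded by \<open>k \<ge> 2\<close> and by
      \<open>k \<le> CARD('m) < CARD('n)\<close>.\<close>
    have "u L \<noteq> 0" if "L \<in> G" for L
    proof
      assume "u L = 0"
      with u[OF that] have "L = {} \<or> L = UNIV" by (auto simp: supports_def)
      moreover have "card L = k" using that by (simp add: G_def)
      ultimately show False using assms by auto
    qed
    then have "0 \<notin> u ` G" by auto
    then obtain w where w: "\<And>a. a \<in> u ` G \<Longrightarrow> w \<bullet> a \<noteq> 0"
      using ex_not_orthogonal_to_finite[of "u ` G"] by auto
    \<comment> \<open>No normal is orthogonal to \<open>w\<close>, so the half-spaces of
      \<open>w\<close> and \<open>- w\<close> share out \<open>G\<close>, and one of them receives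
      at least half.\<close>
    define G1 G2 where "G1 = {L\<in>G. w \<bullet> u L > 0}" and "G2 = {L\<in>G. - w \<bullet> u L > 0}"
    have "L \<in> G1 \<union> G2" if "L \<in> G" for L
      using w[OF imageI[OF that]] that by (auto simp: G1_def G2_def)
    then have "G = G1 \<union> G2" by (auto simp: G1_def G2_def)
    then have "card G \<le> card G1 + card G2" using card_Un_le by blast
    moreover have "\<exists>(A :: ((real, 'n) vec, 'm) vec) c. design A c \<and> card G1 \<le> card (k_loadouts k A c)"
      using u by (intro main[where u=u and w=w]) (auto simp: G1_def G_def)
    moreover have "\<exists>(A :: ((real, 'n) vec, 'm) vec) c. design A c \<and> card G2 \<le> card (k_loadouts k A c)"
      using u by (intro main[where u=u and w="- w"]) (auto simp: G2_def G_def)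
    moreover have "card G \<le> 2 * card G1 \<or> card G \<le> 2 * card G2"
      using calculation(1) by linarith
    ultimately obtain A :: "((real, 'n) vec, 'm) vec" and c
      where A: "design A c" "card G \<le> 2 * card (k_loadouts k A c)"
      by (meson le_trans mult_le_mono2)
    then have "real (face_number (k - 1) P) / 2 \<le> card (k_loadouts k A c)"
      using faces by linarith
    then show ?thesis using A(1) False by auto
  qed
qed

end
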